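(* Let $D_S=(N_S,A_S\cup H_S)$ be a partially time-expanded network with arc capacities $u'$ and holdover storage capacities $b'$ satisfying properties (P1)–(P4), $(P^{\mathtt{arcs}})$ and $(P^{\mathtt{storage}})$. Then the optimal value of $\mathrm{UPR}(D_S)$ is at most the optimal value of $\mathrm{UPR}(D_T)$.
   Context: Base network: a directed graph $D=(N,A)$; each arc $vw\in A$ has a transit time $\tau_{vw}\in\mathbb{N}$ and a capacity $u_{vw}\in\mathbb{N}$; each node $v\in N$ has a storage capacity $b_v\in\mathbb{N}$. $\mathcal{K}$ is a finite set of packets; packet $k$ has origin $s_k$ and destination $t_k$. For $v\in N$ let $\mathcal{K}_v=\{k\in\mathcal{K}: s_k\ne v,\ t_k\ne v\}$. Fix $T\in\mathbb{N}$, $[T]=\{0,\dots,T\}$. Fully time-expanded network $D_T=(N_T,A_T\cup H_T)$: $N_T=\{(v,t):v\in N,t\in[T]\}$; movement arcs $A_T=\{((v,t),(w,t+\tau_{vw})): (v,t)\in N_T, vw\in A, t+\tau_{vw}\le T\}$; holdover arcs $H_T=\{((v,t),(v,t+1)): v\in N, 0\le t<T\}$. $\mathrm{UPR}(D_T)$ is the integer program with binary variables $x^k_e$ ($k\in\mathcal{K}$, $e\in A_T\cup H_T$) and variable $\bar T$: minimize $\bar T$ s.t. $t'x^k_e\le\bar T$ for all $k$, $e=((v,t),(w,t'))\in A_T$; $\sum_{e=((v,t),(w,t'))\in A_T,\,w=t_k}t'x^k_e\le\bar T$ for all $k$; flow conservation for each $k$ at each $(v,t)\in N_T$ (out-flow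 minus in-flow equals $1$ at $(s_k,0)$, $-1$ at $(t_k,T)$, $0$ otherwise); $\sum_k x^k_e\le u_{vw}$ for each copy $e\in A_T$ of $vw$; $\sum_{k\in\mathcal{K}_v}x^k_e\le b_v$ for each holdover arc $e$ at $v$. Partially time-expanded network: $N_S\subseteq N_T$; $\mathtt{n_S}(v,t)=\min\{t'>t:(v,t')\in N_S\}$, $\mathtt{m_S}(v,t)=\mathtt{n_S}(v,t)-t$ (defined even if $(v,t)\notin N_S$); $H_S$ consists of the arcs $((v,t),(v,\mathtt{n_S}(v,t)))$ for $(v,t)\in N_S$, $t<T$; $A_S$ is a set of arcs $((v,t),(w,t'))$ with both ends in $N_S$ and $vw\in A$. Properties: (P1) $(s_k,0),(t_k,T)\in N_S$ for all $k$; (P2) each $((v,t),(w,t'))\in A_S$ has $t'\le t+\tau_{vw}$; (P3) for each $vw\in A$ and $(v,t)\in N_S$ with $t+\tau_{vw}\le T$, $A_S$ contains a copy of $vw$ starting at $(v,t)$; (P4) if $((v,t),(w,t'))\in A_S$ there is no $(w,t'')\in N_S$ with $t'<t''\le t+\tau_{vw}$. $(P^{\mathtt{arcs}})$: every $e=((v,t),(w,t'))\in A_S$ has capacity $u'_e=u_{vw}\,\mathtt{m_S}(v,t)$. Let $N^-_S(v,t)=\{(w,t'):((w,t'),(v,t))\in A_S\}$, $N^-_T(v,t)=\{(w,t'):((w,t'),(v,t))\in A_T\}$, and for $e=((v,t),(v,t'))\in H_S$ let $U_e=\sum_{(w,t')\in N^-_T(v,t)\cup N^-_S(v,t)}u_{wv}(\mathtt{m_S}(w,t')-1)$.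 $(P^{\mathtt{storage}})$: every $e=((v,t),(v,t'))\in H_S$ has $b'_e\ge b_v+U_e$ if $(v,t+1)\in N_S$ and $b'_e\ge 2b_v+U_e$ if $(v,t+1)\notin N_S$. $\mathrm{UPR}(D_S)$ is the integer program with binary variables $x^k_e$ ($k\in\mathcal{K}$, $e\in A_S\cup H_S$) and variable $\bar T$: minimize $\bar T$ s.t. $(t+\tau_{vw})x^k_e\le\bar T$ for all $k$ and $e=((v,t),(w,t'))\in A_S$; $\sum_{e=((v,t),(w,t'))\in A_S,\,w=t_k}(t+\tau_{vw})x^k_e\le\bar T$ for all $k$; flow conservation for each $k$ at each $(v,t)\in N_S$ in $D_S$ (out minus in equals $1$ at $(s_k,0)$, $-1$ at $(t_k,T)$, $0$ otherwise); $\sum_k x^k_e\le u'_e$ for $e\in A_S$; $\sum_{k\in\mathcal{K}_v}x^k_e\le b'_e$ for each $e\in H_S$ at $v$. *)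

theory Defs
  imports "Graph_Theory.Pair_Digraph" "HOL-Library.Extended_Real"
begin

type_synonym 'v tnode = "'v \<times> nat"
type_synonym 'v tarc = "'v tnode \<times> 'v tnode"

record ('v, 'k) routing =
  base :: "'v pair_pre_digraph"
  transit :: "'v \<times> 'v \<Rightarrow> nat"
  capacity :: "'v \<times> 'v \<Rightarrow> nat"
  storage :: "'v \<Rightarrow> nat"
  packets :: "'k set"
  origin :: "'k \<Rightarrow> 'v"
  destination :: "'k \<Rightarrow> 'v"
  horizon :: nat

definition routing_instance :: "('v, 'k) routing \<Rightarrow> bool" where
  "routing_instance I \<longleftrightarrow>
     pair_fin_digraph (base I) \<and> finite (packets I) \<and>
     (\<forall>k \<in> packets I. origin I k \<in> pverts (base I) \<and> destination I k \<in> pverts (base I))"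

definition packets_through :: "('v, 'k) routing \<Rightarrow> 'v \<Rightarrow> 'k set" where
  "packets_through I v = {k \<in> packets I. origin I k \<noteq> v \<and> destination I k \<noteq> v}"

text \<open>
  The integer program on a time-expanded network with nodes \<open>N\<close>, movement arcs \<open>M\<close> and holdover
  arcs \<open>H\<close>, where \<open>arr e\<close> is the arrival time charged for movement arc \<open>e\<close>, and \<open>c\<close> and \<open>s\<close> are
  the capacities of the movement and holdover arcs.

  The binary variables of movement arcs are \<open>x k e\<close> and those of holdover arcs are \<open>y k e\<close>. Thus
  \<open>M\<close> and \<open>H\<close> are treated as disjoint, even if a loop of the base digraph yields a movement arc
  that is the same pair of time nodes as a holdover arc.
\<close>

definition net_outflow ::
  "'v tarc set \<Rightarrow> 'v tarc set \<Rightarrow> ('v tarc \<Rightarrow> real) \<Rightarrow> ('v tarc \<Rightarrow> real) \<Rightarrow> 'v tnode \<Rightarrow> real" where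
  "net_outflow M H f g n =
     ((\<Sum>e | e \<in> M \<and> fst e = n. f e) + (\<Sum>e | e \<in> H \<and> fst e = n. g e))
     - ((\<Sum>e | e \<in> M \<and> snd e = n. f e) + (\<Sum>e | e \<in> H \<and> snd e = n. g e))"

definition flow_conservation ::
  "('v, 'k) routing \<Rightarrow> 'v tnode set \<Rightarrow> 'v tarc set \<Rightarrow> 'v tarc set \<Rightarrow>
   ('k \<Rightarrow> 'v tarc \<Rightarrow> real) \<Rightarrow> ('k \<Rightarrow> 'v tarc \<Rightarrow> real) \<Rightarrow> bool" where
  "flow_conservation I N M H x y \<longleftrightarrow>
     (\<forall>k \<in> packets I. \<forall>n \<in> N.
        (n = (origin I k, 0) \<longrightarrow> net_outflow M H (x k) (y k) n = 1) \<and>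
        (n = (destination I k, horizon I) \<longrightarrow> net_outflow M H (x k) (y k) n = -1) \<and>
        (n \<noteq> (origin I k, 0) \<and> n \<noteq> (destination I k, horizon I) \<longrightarrow>
           net_outflow M H (x k) (y k) n = 0))"

definition upr_feasible ::
  "('v, 'k) routing \<Rightarrow> 'v tnode set \<Rightarrow> 'v tarc set \<Rightarrow> 'v tarc set \<Rightarrow>
   ('v tarc \<Rightarrow> nat) \<Rightarrow> ('v tarc \<Rightarrow> real) \<Rightarrow> ('v tarc \<Rightarrow> real) \<Rightarrow>
   ('k \<Rightarrow> 'v tarc \<Rightarrow> real) \<Rightarrow> ('k \<Rightarrow> 'v tarc \<Rightarrow> real) \<Rightarrow> real \<Rightarrow> bool" where
  "upr_feasible I N M H arr c s x y Tbar \<longleftrightarrow>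
     (\<forall>k \<in> packets I. \<forall>e \<in> M. x k e \<in> {0, 1}) \<and>
     (\<forall>k \<in> packets I. \<forall>e \<in> H. y k e \<in> {0, 1}) \<and>
     (\<forall>k \<in> packets I. \<forall>e \<in> M. real (arr e) * x k e \<le> Tbar) \<and>
     (\<forall>k \<in> packets I.
        (\<Sum>e | e \<in> M \<and> fst (snd e) = destination I k. real (arr e) * x k e) \<le> Tbar) \<and>
     flow_conservation I N M H x y \<and>
     (\<forall>e \<in> M. (\<Sum>k \<in> packets I. x k e) \<le> c e) \<and>
     (\<forall>e \<in> H. (\<Sum>k \<in> packets_through I (fst (fst e)). y k e) \<le> s e)"

text \<open>The optimal value of an infeasible program is \<open>\<infinity>\<close>.\<close>

definition upr_value ::
  "('v, 'k) routing \<Rightarrow> 'v tnode set \<Rightarrow> 'v tarc set \<Rightarrow> 'v tarc set \<Rightarrow>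
   ('v tarc \<Rightarrow> nat) \<Rightarrow> ('v tarc \<Rightarrow> real) \<Rightarrow> ('v tarc \<Rightarrow> real) \<Rightarrow> ereal" where
  "upr_value I N M H arr c s =
     Inf {ereal Tbar | Tbar. \<exists>x y. upr_feasible I N M H arr c s x y Tbar}"

definition base_arc :: "'v tarc \<Rightarrow> 'v \<times> 'v" where
  "base_arc e = (fst (fst e), fst (snd e))"

definition N_T :: "('v, 'k) routing \<Rightarrow> 'v tnode set" where
  "N_T I = pverts (base I) \<times> {0..horizon I}"

definition A_T :: "('v, 'k) routing \<Rightarrow> 'v tarc set" where
  "A_T I = {((v, t), (w, t + transit I (v, w))) | v t w.
     (v, t) \<in> N_T I \<and> (v, w) \<in> parcs (base I) \<and> t + transit I (v, w) \<le> horizon I}"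

definition H_T :: "('v, 'k) routing \<Rightarrow> 'v tarc set" where
  "H_T I = {((v, t), (v, t + 1)) | v t. v \<in> pverts (base I) \<and> t < horizon I}"

definition opt_UPR_T :: "('v, 'k) routing \<Rightarrow> ereal" where
  "opt_UPR_T I = upr_value I (N_T I) (A_T I) (H_T I)
     (\<lambda>e. snd (snd e))
     (\<lambda>e. real (capacity I (base_arc e)))
     (\<lambda>e. real (storage I (fst (fst e))))"

record 'v partial_network =
  N_S :: "'v tnode set"
  A_S :: "'v tarc set"
  cap_S :: "'v tarc \<Rightarrow> real"
  stor_S :: "'v tarc \<Rightarrow> real"

definition partial_network :: "('v, 'k) routing \<Rightarrow> 'v partial_network \<Rightarrow> bool" where
  "partial_network I S \<longleftrightarrow>
     N_S S \<subseteq> N_T I \<and>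
     (\<forall>e \<in> A_S S. fst e \<in> N_S S \<and> snd e \<in> N_S S \<and> base_arc e \<in> parcs (base I))"

text \<open>
  If \<open>v\<close> has no copy after time \<open>t\<close>, we put \<open>n_S I S v t = horizon I + 1\<close>, so that \<open>m_S I S v t\<close>
  always counts the times \<open>t, \<dots>, n_S I S v t - 1\<close> within the horizon. No holdover arc leaves
  such a node. Reading the minimum of the empty set as \<open>\<infinity>\<close> instead would only enlarge the
  capacities in \<open>D_S\<close>.
\<close>

definition n_S :: "('v, 'k) routing \<Rightarrow> 'v partial_network \<Rightarrow> 'v \<Rightarrow> nat \<Rightarrow> nat" where
  "n_S I S v t = (if \<exists>t'>t. (v, t') \<in> N_S S then LEAST t'. t < t' \<and> (v, t') \<in> N_S S
                  else horizon I + 1)"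

definition m_S :: "('v, 'k) routing \<Rightarrow> 'v partial_network \<Rightarrow> 'v \<Rightarrow> nat \<Rightarrow> nat" where
  "m_S I S v t = n_S I S v t - t"

definition H_S :: "('v, 'k) routing \<Rightarrow> 'v partial_network \<Rightarrow> 'v tarc set" where
  "H_S I S = {((v, t), (v, n_S I S v t)) | v t.
     (v, t) \<in> N_S S \<and> t < horizon I \<and> (v, n_S I S v t) \<in> N_S S}"

definition P1 :: "('v, 'k) routing \<Rightarrow> 'v partial_network \<Rightarrow> bool" where
  "P1 I S \<longleftrightarrow> (\<forall>k \<in> packets I.
     (origin I k, 0) \<in> N_S S \<and> (destination I k, horizon I) \<in> N_S S)"

definition P2 :: "('v, 'k) routing \<Rightarrow> 'v partial_network \<Rightarrow> bool" where
  "P2 I S \<longleftrightarrow> (\<forall>v t w t'. ((v, t), (w, t')) \<in> A_S S \<longrightarrow> t' \<le> t + transit I (v, w))"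

definition P3 :: "('v, 'k) routing \<Rightarrow> 'v partial_network \<Rightarrow> bool" where
  "P3 I S \<longleftrightarrow> (\<forall>v w t. (v, w) \<in> parcs (base I) \<and> (v, t) \<in> N_S S \<and>
     t + transit I (v, w) \<le> horizon I \<longrightarrow> (\<exists>t'. ((v, t), (w, t')) \<in> A_S S))"

definition P4 :: "('v, 'k) routing \<Rightarrow> 'v partial_network \<Rightarrow> bool" where
  "P4 I S \<longleftrightarrow> (\<forall>v t w t'. ((v, t), (w, t')) \<in> A_S S \<longrightarrow>
     \<not> (\<exists>t''. (w, t'') \<in> N_S S \<and> t' < t'' \<and> t'' \<le> t + transit I (v, w)))"

definition P_arcs :: "('v, 'k) routing \<Rightarrow> 'v partial_network \<Rightarrow> bool" where
  "P_arcs I S \<longleftrightarrow> (\<forall>v t w t'. ((v, t), (w, t')) \<in> A_S S \<longrightarrow>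
     cap_S S ((v, t), (w, t')) = real (capacity I (v, w) * m_S I S v t))"

definition in_nbrs :: "'v tarc set \<Rightarrow> 'v tnode \<Rightarrow> 'v tnode set" where
  "in_nbrs M n = {p. (p, n) \<in> M}"

text \<open>\<open>U_S I S v t\<close> is the number \<open>U\<^sub>e\<close> of the holdover arc \<open>e\<close> leaving \<open>(v, t)\<close>.\<close>

definition U_S :: "('v, 'k) routing \<Rightarrow> 'v partial_network \<Rightarrow> 'v \<Rightarrow> nat \<Rightarrow> nat" where
  "U_S I S v t = (\<Sum>(w, t') \<in> in_nbrs (A_T I) (v, t) \<union> in_nbrs (A_S S) (v, t).
     capacity I (w, v) * (m_S I S w t' - 1))"

definition P_storage :: "('v, 'k) routing \<Rightarrow> 'v partial_network \<Rightarrow> bool" where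
  "P_storage I S \<longleftrightarrow> (\<forall>v t t'. ((v, t), (v, t')) \<in> H_S I S \<longrightarrow>
     ((v, t + 1) \<in> N_S S \<longrightarrow>
        stor_S S ((v, t), (v, t')) \<ge> real (storage I v + U_S I S v t)) \<and>
     ((v, t + 1) \<notin> N_S S \<longrightarrow>
        stor_S S ((v, t), (v, t')) \<ge> real (2 * storage I v + U_S I S v t)))"

definition opt_UPR_S :: "('v, 'k) routing \<Rightarrow> 'v partial_network \<Rightarrow> ereal" where
  "opt_UPR_S I S = upr_value I (N_S S) (A_S S) (H_S I S)
     (\<lambda>e. snd (fst e) + transit I (base_arc e))
     (cap_S S) (stor_S S)"

end

theory Submission
  imports Defs
begin

text \<open>
  The support of the flow of a packet in \<open>D\<^sub>T\<close> contains a path from its origin to its destination.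
  Rounding the times of this path down to copies in \<open>N\<^sub>S\<close>, replacing each movement arc by the copy
  in \<open>A\<^sub>S\<close> that leaves the rounded tail, and filling the resulting gaps with holdover arcs gives a
  walk in \<open>D\<^sub>S\<close>. This walk may go back in time and reuse arcs; a shortest path among its arcs is a
  binary flow. Arcs of \<open>A\<^sub>S\<close> never depart later than the arcs they replace, so \<open>Tbar\<close> remains
  feasible. A holdover arc from \<open>(v, t)\<close> to \<open>(v, n)\<close> is used either by packets stored at \<open>v\<close> from
  \<open>n - 1\<close> to \<open>n\<close>, at most \<open>b\<^sub>v\<close> many, or by packets whose arrival at \<open>v\<close> moved from \<open>n\<close> or later to
  before \<open>n\<close>, and the latter are counted by \<open>U\<^sub>e\<close>.
\<close>

section \<open>Unit flows and paths\<close>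

text \<open>A cut argument: let \<open>R\<close> be the nodes reachable from \<open>s\<close> along
  the support. If \<open>d\<close> is not in \<open>R\<close>, only \<open>s\<close> contributes to
  the net outflow of \<open>R\<close>, which is then 1. But no support arc leaves \<open>R\<close>,
  so this net outflow is at most 0.\<close>

lemma unit_outflow_imp_support_path:
  fixes f g :: "'v tarc \<Rightarrow> real"
  assumes "finite N" "s \<in> N" "M \<subseteq> N \<times> N" "H \<subseteq> N \<times> N"
    and nonneg: "\<And>e. e \<in> M \<Longrightarrow> 0 \<le> f e" "\<And>e. e \<in> H \<Longrightarrow> 0 \<le> g e"
    and src: "net_outflow M H f g s = 1"
    and snk: "net_outflow M H f g d = - 1"
    and inner: "\<And>n. n \<in> N \<Longrightarrow> n \<noteq> s \<Longrightarrow> n \<noteq> d \<Longrightarrow> net_outflow M H f g n = 0"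
  shows "(s, d) \<in> ({e \<in> M. f e \<noteq> 0} \<union> {e \<in> H. g e \<noteq> 0})\<^sup>*"
proof (rule ccontr)
  let ?E = "{e \<in> M. f e \<noteq> 0} \<union> {e \<in> H. g e \<noteq> 0}"
  define R where "R = ?E\<^sup>* `` {s}"
  assume "(s, d) \<notin> ?E\<^sup>*"
  then have d: "d \<notin> R" by (simp add: R_def)
  have s: "s \<in> R" by (simp add: R_def)
  have "R \<subseteq> N"
  proof
    fix n assume "n \<in> R"
    then have "(s, n) \<in> ?E\<^sup>*" by (simp add: R_def)
    then show "n \<in> N"
      by (induction rule: rtrancl_induct) (use assms(2-4) in auto)
  qed
  then have fin: "finite R" using \<open>finite N\<close> by (rule finite_subset)
  have leave: "(\<Sum>n\<in>R. \<Sum>e | e \<in> A \<and> fst e = n. h e) \<le> (\<Sum>n\<in>R. \<Sum>e | e \<in> A \<and> snd e = n. h e)"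
    if A: "A \<subseteq> N \<times> N" "\<And>e. e \<in> A \<Longrightarrow> 0 \<le> h e" "{e \<in> A. h e \<noteq> 0} \<subseteq> ?E" for A and h :: "'v tarc \<Rightarrow> real"
  proof -
    have finA: "finite A" using A(1) \<open>finite N\<close> by (meson finite_SigmaI finite_subset)
    have fib: "(\<Sum>n\<in>R. \<Sum>e | e \<in> A \<and> \<pi> e = n. h e) = (\<Sum>e | e \<in> A \<and> \<pi> e \<in> R. h e)"
      for \<pi> :: "'v tarc \<Rightarrow> 'v tnode"
    proof -
      have "(\<Sum>e | e \<in> A \<and> \<pi> e \<in> R. h e)
          = (\<Sum>n\<in>R. \<Sum>e | e \<in> {e. e \<in> A \<and> \<pi> e \<in> R} \<and> \<pi> e = n. h e)"
        by (rule sum.group[symmetric]) (use finA fin in auto)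
      also have "\<dots> = (\<Sum>n\<in>R. \<Sum>e | e \<in> A \<and> \<pi> e = n. h e)"
        by (intro sum.cong) auto
      finally show ?thesis by simp
    qed
    have step: "snd e \<in> R" if "e \<in> A" "h e \<noteq> 0" "fst e \<in> R" for e
    proof -
      have "(fst e, snd e) \<in> ?E" using that A(3) by auto
      moreover have "(s, fst e) \<in> ?E\<^sup>*" using that(3) by (simp add: R_def)
      ultimately have "(s, snd e) \<in> ?E\<^sup>*" by (rule rtrancl_into_rtrancl[rotated])
      then show ?thesis by (simp add: R_def)
    qed
    \<comment> \<open>Arcs of value zero are dropped first, since only they can leave
      \<open>R\<close>; the remaining arcs with tail in \<open>R\<close> are among those with head
      in \<open>R\<close>.\<close>
    have "(\<Sum>e | e \<in> A \<and> fst e \<in> R. h e) = (\<Sum>e | e \<in> A \<and> h e \<noteq> 0 \<and> fst e \<in> R. h e)"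
      by (rule sum.mono_neutral_right) (use finA in auto)
    also have "\<dots> \<le> (\<Sum>e | e \<in> A \<and> snd e \<in> R. h e)"
      by (rule sum_mono2) (use finA step A(2) in auto)
    finally show ?thesis by (simp add: fib)
  qed
  have "(\<Sum>n\<in>R. net_outflow M H f g n) \<le> 0"
    using leave[OF assms(3), of f] leave[OF assms(4), of g] nonneg
    by (fastforce simp: net_outflow_def sum_subtractf sum.distrib)
  moreover have "(\<Sum>n\<in>R. net_outflow M H f g n) = (\<Sum>n\<in>{s}. net_outflow M H f g n)"
    by (rule sum.mono_neutral_right) (use fin s d inner \<open>R \<subseteq> N\<close> in auto)
  ultimately show False using src by simp
qed

text \<open>Along a shortest walk the distance from the start increases, so no arc is repeated.\<close>

lemma rtrancl_imp_unit_flow: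
  fixes E :: "('a \<times> 'a) set"
  assumes "(s, d) \<in> E\<^sup>*"
  obtains P where "finite P" "P \<subseteq> E"
    "\<And>n. real (card {e \<in> P. fst e = n}) - real (card {e \<in> P. snd e = n})
       = of_bool (n = s) - of_bool (n = d)"
proof -
  define dist where "dist n = (LEAST i. (s, n) \<in> E ^^ i)" for n
  have "\<exists>P. finite P \<and> P \<subseteq> E \<and> (\<forall>e\<in>P. dist (snd e) \<le> i) \<and>
      (\<forall>n. real (card {e \<in> P. fst e = n}) - real (card {e \<in> P. snd e = n})
         = of_bool (n = s) - of_bool (n = d))"
    if "(s, d) \<in> E ^^ i" "dist d = i" for i d
    using that
  proof (induction i arbitrary: d)
    case 0
    then show ?case by (intro exI[of _ "{}"]) auto
  next
    case (Suc i)
    from Suc.prems(1) obtain u where u: "(s, u) \<in> E ^^ i" "(u, d) \<in> E" by auto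
    have "(s, u) \<in> E ^^ dist u" unfolding dist_def by (rule LeastI) (rule u(1))
    then have "(s, d) \<in> E ^^ Suc (dist u)" using u(2) by auto
    then have "dist d \<le> Suc (dist u)" unfolding dist_def by (rule Least_le)
    moreover have "dist u \<le> i" unfolding dist_def using u(1) by (rule Least_le)
    \<comment> \<open>The predecessor lies at distance exactly \<open>i\<close>, as the induction
      hypothesis requires.\<close>
    ultimately have "dist u = i" using Suc.prems(2) by simp
    then obtain P where P: "finite P" "P \<subseteq> E" "\<forall>e\<in>P. dist (snd e) \<le> i"
      "\<And>n. real (card {e \<in> P. fst e = n}) - real (card {e \<in> P. snd e = n})
         = of_bool (n = s) - of_bool (n = u)"
      using Suc.IH[OF u(1)] by blast
    have new: "(u, d) \<notin> P" using P(3) Suc.prems(2) by fastforce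
    have ins: "card {e \<in> insert (u, d) P. \<pi> e = n}
        = card {e \<in> P. \<pi> e = n} + of_bool (\<pi> (u, d) = n)" for \<pi> :: "'a \<times> 'a \<Rightarrow> 'a" and n
    proof -
      have "{e \<in> insert (u, d) P. \<pi> e = n}
          = (if \<pi> (u, d) = n then insert (u, d) {e \<in> P. \<pi> e = n} else {e \<in> P. \<pi> e = n})"
        by auto
      then show ?thesis using new P(1) by simp
    qed
    show ?case
    proof (intro exI[of _ "insert (u, d) P"] conjI allI ballI)
      fix n
      show "real (card {e \<in> insert (u, d) P. fst e = n}) - real (card {e \<in> insert (u, d) P. snd e = n})
         = of_bool (n = s) - of_bool (n = d)"
        using P(4)[of n] unfolding ins by auto
    qed (use P u Suc.prems(2) in \<open>auto intro: le_SucI\<close>)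
  qed
  moreover obtain i where "(s, d) \<in> E ^^ i" using assms by (auto simp: rtrancl_power)
  then have "(s, d) \<in> E ^^ dist d" unfolding dist_def by (rule LeastI)
  ultimately show ?thesis using that by blast
qed

text \<open>\<open>X\<close> selects the arcs of \<open>P\<close> that serve as movement arcs. A
  pair may lie in both \<open>M\<close> and \<open>H\<close>; splitting \<open>P\<close> along
  \<open>X\<close> counts it only once.\<close>

lemma net_outflow_indicator:
  assumes "finite M" "finite H" "X \<subseteq> M" "P - X \<subseteq> H"
  shows "net_outflow M H (\<lambda>e. of_bool (e \<in> P \<inter> X)) (\<lambda>e. of_bool (e \<in> P - X)) n
    = real (card {e \<in> P. fst e = n}) - real (card {e \<in> P. snd e = n})"
proof -
  have one: "(\<Sum>e | e \<in> A \<and> \<pi> e = n. of_bool (e \<in> B)) = real (card {e \<in> B. \<pi> e = n})"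
    if "B \<subseteq> A" "finite A" for A B and \<pi> :: "'a tarc \<Rightarrow> 'a tnode"
  proof -
    have "(\<Sum>e | e \<in> A \<and> \<pi> e = n. of_bool (e \<in> B)) = (\<Sum>e | e \<in> B \<and> \<pi> e = n. (1::real))"
      by (intro sum.mono_neutral_cong_right) (use that in auto)
    then show ?thesis by simp
  qed
  have "finite (P \<inter> X)" "finite (P - X)"
    using assms by (auto intro: finite_subset)
  then have "card {e \<in> P \<inter> X. \<pi> e = n} + card {e \<in> P - X. \<pi> e = n} = card {e \<in> P. \<pi> e = n}"
    for \<pi> :: "'a tarc \<Rightarrow> 'a tnode"
    by (subst card_Un_disjoint[symmetric])
      (auto intro: arg_cong[where f = card] finite_subset[of _ "P \<inter> X"] finite_subset[of _ "P - X"])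
  from this[of fst] this[of snd] show ?thesis
    unfolding net_outflow_def
    using assms one[of "P \<inter> X" M] one[of "P - X" H] by (simp add: le_infI2)
qed

section \<open>Rounding down to a partially time-expanded network\<close>

locale partial_expansion =
  fixes I :: "('v, 'k) routing" and S :: "'v partial_network"
  assumes routing: "routing_instance I"
    and network: "partial_network I S"
    and P1: "P1 I S" and P2: "P2 I S" and P3: "P3 I S" and P4: "P4 I S"
    and P_arcs: "P_arcs I S" and P_storage: "P_storage I S"
begin

abbreviation next_copy :: "'v \<Rightarrow> nat \<Rightarrow> nat" where
  "next_copy \<equiv> n_S I S"

text \<open>Time \<open>t\<close> at \<open>v\<close> rounds down to \<open>r\<close>, the last copy
  of \<open>v\<close> no later than \<open>t\<close>. This is a relation because \<open>v\<close>
  may have no copy that early.\<close>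

definition covers :: "'v \<Rightarrow> nat \<Rightarrow> nat \<Rightarrow> bool" where
  "covers v r t \<longleftrightarrow> (v, r) \<in> N_S S \<and> r \<le> t \<and> t < next_copy v r"

lemma finite_N_T: "finite (N_T I)"
  using routing by (simp add: N_T_def routing_instance_def pair_fin_digraph_def
      pair_fin_digraph_axioms_def)

lemma A_T_subset: "A_T I \<subseteq> N_T I \<times> N_T I"
proof -
  interpret pair_fin_digraph "base I" using routing by (simp add: routing_instance_def)
  show ?thesis using in_arcsD2 by (auto simp: A_T_def N_T_def)
qed

lemma H_T_subset: "H_T I \<subseteq> N_T I \<times> N_T I"
  by (auto simp: H_T_def N_T_def)

lemma N_S_subset: "N_S S \<subseteq> N_T I"
  using network by (simp add: partial_network_def)

lemma N_S_le_horizon: "(v, t) \<in> N_S S \<Longrightarrow> t \<le> horizon I"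
  using N_S_subset by (auto simp: N_T_def)

lemma finite_A_T: "finite (A_T I)"
  using A_T_subset finite_N_T by (meson finite_SigmaI finite_subset)

lemma finite_A_S: "finite (A_S S)"
proof (rule finite_subset)
  show "A_S S \<subseteq> N_T I \<times> N_T I"
    using network N_S_subset by (force simp: partial_network_def)
qed (simp add: finite_N_T)

lemma finite_H_S: "finite (H_S I S)"
proof (rule finite_subset)
  show "H_S I S \<subseteq> N_T I \<times> N_T I"
    using N_S_subset by (auto simp: H_S_def)
qed (simp add: finite_N_T)

section \<open>Copies of a node and the rounding of times\<close>

lemma next_copy_le: "(v, t') \<in> N_S S \<Longrightarrow> t < t' \<Longrightarrow> next_copy v t \<le> t'"
  by (auto simp: n_S_def intro: Least_le)

text \<open>A value within the horizon is not the default \<open>horizon I + 1\<close>, so it is an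
  actual copy.\<close>

lemma next_copy_in:
  assumes "next_copy v t \<le> horizon I"
  shows "(v, next_copy v t) \<in> N_S S"
proof -
  have ex: "\<exists>t'>t. (v, t') \<in> N_S S" using assms by (auto simp: n_S_def split: if_splits)
  then show ?thesis using LeastI_ex[of "\<lambda>t'. t < t' \<and> (v, t') \<in> N_S S"] by (auto simp: n_S_def)
qed

lemma next_copy_gt:
  assumes "t \<le> horizon I"
  shows "t < next_copy v t"
  using assms LeastI_ex[of "\<lambda>t'. t < t' \<and> (v, t') \<in> N_S S"] by (auto simp: n_S_def)

text \<open>Needed for tails of arcs in \<open>A_T I\<close> whose time \<open>q\<close> is not a
  copy: they share the next copy of the time to which they round.\<close>

lemma next_copy_eq:
  assumes "r \<le> q" "q < next_copy v r"
  shows "next_copy v q = next_copy v r"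
proof -
  have "(q < t' \<and> (v, t') \<in> N_S S) = (r < t' \<and> (v, t') \<in> N_S S)" for t'
    using assms next_copy_le[of v t' r] by auto
  then show ?thesis unfolding n_S_def by presburger
qed

lemma covers_self: "(v, t) \<in> N_S S \<Longrightarrow> covers v t t"
  by (simp add: covers_def N_S_le_horizon next_copy_gt)

lemma covers_exists:
  assumes "(v, p) \<in> N_S S" "p \<le> t" "t \<le> horizon I"
  obtains r where "covers v r t" "p \<le> r"
proof
  let ?r = "GREATEST r. (v, r) \<in> N_S S \<and> r \<le> t"
  have r: "(v, ?r) \<in> N_S S \<and> ?r \<le> t"
    by (rule GreatestI_nat[of _ p t]) (use assms in auto)
  have max: "r \<le> ?r" if "(v, r) \<in> N_S S" "r \<le> t" for r
    by (rule Greatest_le_nat[of _ _ t]) (use that in auto)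
  have "t < next_copy v ?r"
  proof (rule ccontr)
    assume *: "\<not> t < next_copy v ?r"
    then have "next_copy v ?r \<le> ?r" using next_copy_in[of v ?r] max assms(3) by auto
    then show False using next_copy_gt[of ?r v] r assms(3) by auto
  qed
  with r show "covers v ?r t" by (simp add: covers_def)
  show "p \<le> ?r" by (rule max) (use assms in auto)
qed

lemma covers_unique:
  assumes "covers v r t" "covers v r' t"
  shows "r = r'"
proof (rule linorder_cases[of r r'])
  show ?thesis if "r < r'" using assms next_copy_le[of v r' r] that by (simp add: covers_def)
  show ?thesis if "r' < r" using assms next_copy_le[of v r r'] that by (simp add: covers_def)
qed

section \<open>Movement arcs leaving a rounded tail\<close>

lemma A_S_nodes:
  "((v, r), (w, t)) \<in> A_S S \<Longrightarrow> (v, r) \<in> N_S S \<and> (w, t) \<in> N_S S \<and> (v, w) \<in> parcs (base I)"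
  using network by (force simp: partial_network_def base_arc_def)

text \<open>By P2 the later head is within the transit time, so P4 for the arc with the earlier head
  excludes it.\<close>

lemma A_S_head_unique:
  assumes "((v, r), (w, t)) \<in> A_S S" "((v, r), (w, t')) \<in> A_S S"
  shows "t = t'"
proof -
  have "\<not> t < t'" if "((v, r), (w, t)) \<in> A_S S" "((v, r), (w, t')) \<in> A_S S" for t t'
    using that P2 P4 A_S_nodes unfolding P2_def P4_def by blast
  from this[OF assms] this[OF assms(2,1)] show ?thesis by simp
qed

abbreviation move_arc :: "'v \<Rightarrow> 'v \<Rightarrow> nat \<Rightarrow> 'v tarc" where
  "move_arc v w a \<equiv> ((v, a), (w, a + transit I (v, w)))"

text \<open>An earlier departure still arrives within the horizon, so P3 supplies a copy. By P2 and
  P4 its head is the last copy of \<open>w\<close> no later than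
  \<open>r + transit I (v, w)\<close>.\<close>

lemma A_S_exists:
  assumes "covers v r t" "move_arc v w t \<in> A_T I"
  obtains p where "((v, r), (w, p)) \<in> A_S S" "(w, p) \<in> N_S S" "p \<le> r + transit I (v, w)"
    "\<And>n. (w, n) \<in> N_S S \<Longrightarrow> n \<le> r + transit I (v, w) \<Longrightarrow> n \<le> p"
proof -
  have "(v, r) \<in> N_S S" "(v, w) \<in> parcs (base I)" "r + transit I (v, w) \<le> horizon I"
    using assms by (auto simp: covers_def A_T_def)
  then obtain p where p: "((v, r), (w, p)) \<in> A_S S" using P3 unfolding P3_def by blast
  show ?thesis
  proof (rule that[OF p])
    show "(w, p) \<in> N_S S" using A_S_nodes[OF p] by simp
    show "p \<le> r + transit I (v, w)" using P2 p unfolding P2_def by blast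
    show "n \<le> p" if "(w, n) \<in> N_S S" "n \<le> r + transit I (v, w)" for n
      using P4 p that unfolding P4_def by (meson not_le)
  qed
qed

section \<open>The rounded walk\<close>

definition moved :: "('v tarc \<Rightarrow> real) \<Rightarrow> 'v tarc set" where
  "moved f = {((v, r), (w, t')) | v r w t'. ((v, r), (w, t')) \<in> A_S S \<and>
     (\<exists>a. covers v r a \<and> ((v, a), (w, a + transit I (v, w))) \<in> A_T I \<and>
          f ((v, a), (w, a + transit I (v, w))) \<noteq> 0)}"

text \<open>
  A copy of an arc \<open>wv\<close> that starts at the earlier time \<open>r\<close> instead of \<open>a\<close> may reach \<open>v\<close> before
  the copy of \<open>v\<close> at time \<open>n\<close> although the original arc reaches it after; then the packet has to
  wait on the holdover arc that ends at time \<open>n\<close>.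
\<close>

definition held :: "('v tarc \<Rightarrow> real) \<Rightarrow> ('v tarc \<Rightarrow> real) \<Rightarrow> 'v tarc set" where
  "held f g = {((v, t), (v, n)) | v t n. ((v, t), (v, n)) \<in> H_S I S \<and>
     (g ((v, n - 1), (v, n)) \<noteq> 0 \<or>
      (\<exists>w r a. covers w r a \<and> ((w, a), (v, a + transit I (w, v))) \<in> A_T I \<and>
          f ((w, a), (v, a + transit I (w, v))) \<noteq> 0 \<and>
          r + transit I (w, v) < n \<and> n \<le> a + transit I (w, v)))}"

lemma holdover_path:
  assumes "(v, p) \<in> N_S S" "(v, r) \<in> N_S S" "p \<le> r"
    and "\<And>t. (v, t) \<in> N_S S \<Longrightarrow> p \<le> t \<Longrightarrow> next_copy v t \<le> r \<Longrightarrow> ((v, t), (v, next_copy v t)) \<in> E"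
  shows "((v, p), (v, r)) \<in> E\<^sup>*"
  using assms
proof (induction "r - p" arbitrary: p rule: less_induct)
  case less
  show ?case
  proof (cases "p = r")
    case False
    let ?n = "next_copy v p"
    have n: "?n \<le> r" "p < ?n"
      using False less.prems next_copy_le next_copy_gt N_S_le_horizon by auto
    then have "(v, ?n) \<in> N_S S"
      using next_copy_in N_S_le_horizon[OF less.prems(2)] by auto
    then have "((v, ?n), (v, r)) \<in> E\<^sup>*"
      using less.hyps[of ?n] less.prems n False by auto
    then show ?thesis
      using less.prems(4)[of p] less.prems(1) n by (auto intro: converse_rtrancl_into_rtrancl)
  qed simp
qed

text \<open>Induction along the path, keeping a walk that ends at the rounding of the current node.
  \<open>moved\<close> and \<open>held\<close> depend on the flow only, not on the chosen path,
  which lets the load bounds be proved from the flow alone.\<close>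

lemma path_rounding:
  assumes "((s, 0), (v, t)) \<in> ({e \<in> A_T I. f e \<noteq> 0} \<union> {e \<in> H_T I. g e \<noteq> 0})\<^sup>*"
    and s: "(s, 0) \<in> N_S S"
  shows "\<exists>r. covers v r t \<and> ((s, 0), (v, r)) \<in> (moved f \<union> held f g)\<^sup>*"
  using assms(1)
proof (induction rule: rtrancl_induct2)
  case refl
  show ?case using covers_self[OF s] by blast
next
  case (step v t w t')
  let ?E = "moved f \<union> held f g"
  from step.IH obtain r where r: "covers v r t" "((s, 0), (v, r)) \<in> ?E\<^sup>*" by blast
  from step.hyps(2) consider
    (move) "((v, t), (w, t')) \<in> A_T I" "f ((v, t), (w, t')) \<noteq> 0"
    | (hold) "((v, t), (w, t')) \<in> H_T I" "g ((v, t), (w, t')) \<noteq> 0" by blast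
  then show ?case
  proof cases
    case move
    let ?\<tau> = "transit I (v, w)"
    from move(1) have t': "t' = t + ?\<tau>" "t' \<le> horizon I" "(v, w) \<in> parcs (base I)"
      by (auto simp: A_T_def)
    then obtain p where p: "((v, r), (w, p)) \<in> A_S S" and pN: "(w, p) \<in> N_S S"
      and p_le: "p \<le> r + ?\<tau>" and p_max: "\<And>n. (w, n) \<in> N_S S \<Longrightarrow> n \<le> r + ?\<tau> \<Longrightarrow> n \<le> p"
      using A_S_exists[OF r(1), of w] move(1) by metis
    have mv: "((v, r), (w, p)) \<in> ?E"
      using p r(1) move t'(1) by (auto simp: moved_def)
    have "p \<le> t'" using p_le r(1) t'(1) by (simp add: covers_def)
    then obtain q where q: "covers w q t'" "p \<le> q" using covers_exists[OF pN _ t'(2)] by blast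
    have "((w, p), (w, q)) \<in> ?E\<^sup>*"
    proof (rule holdover_path[OF pN _ q(2)])
      show "(w, q) \<in> N_S S" using q(1) by (simp add: covers_def)
    next
      fix i assume i: "(w, i) \<in> N_S S" "p \<le> i" "next_copy w i \<le> q"
      let ?n = "next_copy w i"
      have "q \<le> t'" using q(1) by (simp add: covers_def)
      then have n: "?n \<le> t'" "i < ?n"
        using i next_copy_gt N_S_le_horizon by auto
      then have nN: "(w, ?n) \<in> N_S S" using next_copy_in t'(2) by auto
      \<comment> \<open>\<open>p\<close> is the last copy of \<open>w\<close> reached by time
        \<open>r + ?\<tau>\<close>, and \<open>?n\<close> is a later copy. Together with
        \<open>?n \<le> t'\<close> this is the early arrival condition of \<open>held\<close>, with
        \<open>t\<close> as the original departure.\<close>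
      have early: "r + ?\<tau> < ?n"
        using p_max[OF nN] i(2) n(2) by linarith
      have "i < horizon I" using N_S_le_horizon[OF nN] n(2) by simp
      then have arc: "((w, i), (w, ?n)) \<in> H_S I S" using i(1) nN by (auto simp: H_S_def)
      then show "((w, i), (w, ?n)) \<in> ?E"
        unfolding held_def using arc early r(1) move n(1) t'(1) by blast
    qed
    with r(2) mv have "((s, 0), (w, q)) \<in> ?E\<^sup>*"
      by (meson rtrancl.rtrancl_into_rtrancl rtrancl_trans)
    with q(1) show ?thesis by blast
  next
    case hold
    then have w: "w = v" "t' = t + 1" "t' \<le> horizon I" by (auto simp: H_T_def)
    show ?thesis
    proof (cases "t' < next_copy v r")
      case True
      then have "covers w r t'" using r(1) w by (auto simp: covers_def)
      then show ?thesis using r(2) w by blast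
    next
      case False
      \<comment> \<open>The rounding changes only if \<open>t'\<close> is itself a copy; the used
        unit arc from \<open>t' - 1\<close> to \<open>t'\<close> then puts the holdover arc into
        \<open>held\<close>.\<close>
      then have n: "next_copy v r = t'" using r(1) w by (auto simp: covers_def)
      then have N: "(v, t') \<in> N_S S" using next_copy_in w by metis
      have "((v, r), (v, t')) \<in> H_S I S"
        using n N r(1) w by (auto simp: H_S_def covers_def)
      then have "((v, r), (v, t')) \<in> ?E"
        using hold w by (auto simp: held_def)
      then show ?thesis using r(2) covers_self[OF N] w by (meson rtrancl.rtrancl_into_rtrancl)
    qed
  qed
qed

section \<open>Loads and arrival times of the rounded arcs\<close>

definition restrict_A_T :: "('v tarc \<Rightarrow> real) \<Rightarrow> 'v tarc \<Rightarrow> real" where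
  "restrict_A_T f e = (if e \<in> A_T I then f e else 0)"

text \<open>The replaced arc departs at one of the \<open>m_S I S v r\<close> times that round to
  \<open>r\<close>, which is the factor in \<open>P_arcs\<close>. Extending \<open>f\<close> by zero
  allows the sum to run over all these times, including those whose arc would exceed the
  horizon.\<close>

lemma moved_le:
  assumes f: "\<And>e. e \<in> A_T I \<Longrightarrow> f e \<in> {0, 1}"
  shows "of_bool (((v, r), (w, t)) \<in> moved f)
    \<le> (\<Sum>a\<in>{r..<next_copy v r}. restrict_A_T f (move_arc v w a))"
proof -
  have nonneg: "0 \<le> restrict_A_T f e" for e using f[of e] by (auto simp: restrict_A_T_def)
  show ?thesis
  proof (cases "((v, r), (w, t)) \<in> moved f")
    case True
    then obtain a where a: "covers v r a" "move_arc v w a \<in> A_T I" "f (move_arc v w a) \<noteq> 0"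
      by (auto simp: moved_def)
    then have "1 = restrict_A_T f (move_arc v w a)" using f by (auto simp: restrict_A_T_def)
    also have "\<dots> \<le> (\<Sum>a\<in>{r..<next_copy v r}. restrict_A_T f (move_arc v w a))"
      by (rule member_le_sum) (use a nonneg in \<open>auto simp: covers_def\<close>)
    finally show ?thesis using True by simp
  next
    case False
    then show ?thesis using nonneg by (simp add: sum_nonneg)
  qed
qed

definition in_copies :: "'v \<Rightarrow> nat \<Rightarrow> 'v tnode set" where
  "in_copies v t = in_nbrs (A_T I) (v, t) \<union> in_nbrs (A_S S) (v, t)"

lemma finite_in_copies: "finite (in_copies v t)"
proof (rule finite_subset)
  show "in_copies v t \<subseteq> N_T I"
    using A_T_subset A_S_nodes N_S_subset by (fastforce simp: in_copies_def in_nbrs_def)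
qed (rule finite_N_T)

text \<open>
  For \<open>q\<close> we take \<open>r\<close> if the arc of \<open>A_S S\<close> from \<open>(w, r)\<close> ends in \<open>(v, t)\<close>. Otherwise it ends
  before \<open>(v, t)\<close>, and we take the tail of the arc of \<open>A_T I\<close> into \<open>(v, t)\<close>, which lies between \<open>r\<close>
  and \<open>a\<close>.
\<close>

lemma early_arrival_in_copies:
  assumes t: "(v, t) \<in> N_S S" and n: "n = next_copy v t"
    and cov: "covers w r a" and A: "move_arc w v a \<in> A_T I"
    and early: "r + transit I (w, v) < n" "n \<le> a + transit I (w, v)"
  obtains q where "(w, q) \<in> in_copies v t" "q < a" "a < next_copy w q"
proof (cases "t \<le> r + transit I (w, v)")
  case True
  let ?\<tau> = "transit I (w, v)"
  have wr: "(w, r) \<in> N_S S" "r \<le> a" "a < next_copy w r" using cov by (auto simp: covers_def)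
  obtain p where p: "((w, r), (v, p)) \<in> A_S S" and pN: "(v, p) \<in> N_S S"
    and p_le: "p \<le> r + ?\<tau>" and "t \<le> p"
    using A_S_exists[OF cov A] t True by metis
  then have "p = t" using next_copy_le[of v p t] early(1) n by (cases "t < p") auto
  then have "(w, r) \<in> in_copies v t" using p by (simp add: in_copies_def in_nbrs_def)
  then show ?thesis using that[of r] early wr by auto
next
  case False
  let ?\<tau> = "transit I (w, v)" and ?q = "t - transit I (w, v)"
  have wr: "r \<le> a" "a < next_copy w r" using cov by (auto simp: covers_def)
  have "t < n" using n t N_S_le_horizon next_copy_gt by simp
  then have q: "r < ?q" "?q < a" "?q + ?\<tau> = t" using False early by auto
  then have "next_copy w ?q = next_copy w r" using next_copy_eq[of r ?q w] wr by auto
  moreover have "(w, ?q) \<in> in_copies v t"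
    using A q N_S_le_horizon[OF t] unfolding in_copies_def in_nbrs_def A_T_def N_T_def by auto
  ultimately show ?thesis using that[of ?q] q wr by auto
qed

text \<open>A held arc is charged to the last unit holdover arc before \<open>n\<close> or, by
  \<open>early_arrival_in_copies\<close>, to a used departure strictly between \<open>q\<close> and
  its next copy. Omitting \<open>q\<close> leaves \<open>m_S I S w q - 1\<close> times, the factor
  in \<open>U_S\<close>.\<close>

lemma held_le:
  assumes f: "\<And>e. e \<in> A_T I \<Longrightarrow> f e \<in> {0, 1}" and g: "\<And>e. e \<in> H_T I \<Longrightarrow> g e \<in> {0, 1}"
    and e: "((v, t), (v, n)) \<in> H_S I S"
  shows "of_bool (((v, t), (v, n)) \<in> held f g) \<le> g ((v, n - 1), (v, n)) +
    (\<Sum>(w, q)\<in>in_copies v t. \<Sum>a\<in>{q<..<next_copy w q}. restrict_A_T f (move_arc w v a))"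
    (is "?l \<le> ?g + ?sum")
proof -
  have nonneg: "0 \<le> restrict_A_T f e" for e using f[of e] by (auto simp: restrict_A_T_def)
  then have sum0: "0 \<le> ?sum" by (intro sum_nonneg) (auto intro: sum_nonneg)
  have t: "(v, t) \<in> N_S S" "n = next_copy v t" "(v, n) \<in> N_S S" using e by (auto simp: H_S_def)
  have "t < n" using next_copy_gt N_S_le_horizon t by auto
  then have "((v, n - 1), (v, n)) \<in> H_T I"
    using t(3) N_S_subset by (fastforce simp: H_T_def N_T_def)
  then have g01: "?g \<in> {0, 1}" by (rule g)
  show ?thesis
  proof (cases "((v, t), (v, n)) \<in> held f g \<and> ?g = 0")
    case True
    then obtain w r a where a: "covers w r a" "move_arc w v a \<in> A_T I" "f (move_arc w v a) \<noteq> 0"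
      "r + transit I (w, v) < n" "n \<le> a + transit I (w, v)"
      by (auto simp: held_def)
    obtain q where q: "(w, q) \<in> in_copies v t" "q < a" "a < next_copy w q"
      by (rule early_arrival_in_copies[OF t(1,2) a(1,2,4,5)])
    have "1 = restrict_A_T f (move_arc w v a)" using a f by (auto simp: restrict_A_T_def)
    also have "\<dots> \<le> (\<Sum>a\<in>{q<..<next_copy w q}. restrict_A_T f (move_arc w v a))"
      by (rule member_le_sum) (use q nonneg in auto)
    also have "\<dots> = (case (w, q) of (w, q) \<Rightarrow> \<Sum>a\<in>{q<..<next_copy w q}. restrict_A_T f (move_arc w v a))"
      by simp
    also have "\<dots> \<le> ?sum"
      by (rule member_le_sum) (use q nonneg finite_in_copies in \<open>auto intro: sum_nonneg\<close>)
    finally show ?thesis using True by simp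
  next
    case False
    then show ?thesis using g01 sum0 by auto
  qed
qed

text \<open>Each arc of \<open>P\<close> is mapped to a used arc of \<open>A_T I\<close> that it
  replaces, whose arrival is no earlier than the time charged for it. The map is injective: the
  departure determines the rounded tail, and tail and base arc determine the head.\<close>

lemma arrival_sum_le:
  assumes f: "\<And>e. e \<in> A_T I \<Longrightarrow> f e \<in> {0, 1}" and P: "P \<subseteq> moved f"
  shows "(\<Sum>e | e \<in> A_S S \<and> fst (snd e) = d.
      real (snd (fst e) + transit I (base_arc e)) * of_bool (e \<in> P))
    \<le> (\<Sum>e | e \<in> A_T I \<and> fst (snd e) = d. real (snd (snd e)) * f e)" (is "?l \<le> ?r")
proof -
  let ?D = "{e \<in> A_S S. fst (snd e) = d \<and> e \<in> P}"
  have finD: "finite ?D" using finite_A_S by simp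
  have "\<exists>c. \<forall>e\<in>?D. c e \<in> A_T I \<and> base_arc (c e) = base_arc e \<and> f (c e) = 1 \<and>
      covers (fst (fst e)) (snd (fst e)) (snd (fst (c e))) \<and>
      snd (snd (c e)) = snd (fst (c e)) + transit I (base_arc e)"
  proof (rule bchoice, rule ballI)
    fix e assume "e \<in> ?D"
    then have "e \<in> moved f" using P by auto
    then obtain v r w t a where a: "e = ((v, r), (w, t))" "covers v r a" "move_arc v w a \<in> A_T I"
      "f (move_arc v w a) \<noteq> 0" by (auto simp: moved_def)
    then show "\<exists>c. c \<in> A_T I \<and> base_arc c = base_arc e \<and> f c = 1 \<and>
      covers (fst (fst e)) (snd (fst e)) (snd (fst c)) \<and>
      snd (snd c) = snd (fst c) + transit I (base_arc e)"
      using f[OF a(3)] by (intro exI[of _ "move_arc v w a"]) (auto simp: base_arc_def)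
  qed
  then obtain c where c: "\<And>e. e \<in> ?D \<Longrightarrow> c e \<in> A_T I \<and> base_arc (c e) = base_arc e \<and> f (c e) = 1 \<and>
      covers (fst (fst e)) (snd (fst e)) (snd (fst (c e))) \<and>
      snd (snd (c e)) = snd (fst (c e)) + transit I (base_arc e)" by blast
  have inj: "inj_on c ?D"
  proof (rule inj_onI)
    fix e e' assume e: "e \<in> ?D" "e' \<in> ?D" "c e = c e'"
    obtain v r w t v' r' w' t' where eq: "e = ((v, r), (w, t))" "e' = ((v', r'), (w', t'))"
      by (metis prod.collapse)
    have "v' = v" "w' = w" using c[OF e(1)] c[OF e(2)] e(3) eq by (auto simp: base_arc_def)
    moreover from this have "r' = r"
      using c[OF e(1)] c[OF e(2)] e(3) eq covers_unique by auto
    ultimately show "e = e'" using e eq A_S_head_unique by auto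
  qed
  have "?l = (\<Sum>e\<in>?D. real (snd (fst e) + transit I (base_arc e)))"
    by (rule sum.mono_neutral_cong_right) (use finite_A_S in auto)
  also have "\<dots> \<le> (\<Sum>e\<in>?D. real (snd (snd (c e))) * f (c e))"
    by (rule sum_mono) (use c in \<open>auto simp: covers_def\<close>)
  also have "\<dots> = (\<Sum>e\<in>c ` ?D. real (snd (snd e)) * f e)"
    using inj by (simp add: sum.reindex)
  also have "\<dots> \<le> ?r"
  proof (rule sum_mono2)
    show "c ` ?D \<subseteq> {e. e \<in> A_T I \<and> fst (snd e) = d}"
      using c by (auto simp: base_arc_def)
    show "0 \<le> real (snd (snd e)) * f e" if "e \<in> {e. e \<in> A_T I \<and> fst (snd e) = d} - c ` ?D" for e
      using that f[of e] by auto
  qed (use finite_A_T in simp)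
  finally show ?thesis .
qed

section \<open>Transfer of feasible solutions to the partial network\<close>

lemma feasible_rounding:
  assumes feas: "upr_feasible I (N_T I) (A_T I) (H_T I) (\<lambda>e. snd (snd e))
     (\<lambda>e. real (capacity I (base_arc e))) (\<lambda>e. real (storage I (fst (fst e)))) x y Tbar"
  shows "\<exists>x' y'. upr_feasible I (N_S S) (A_S S) (H_S I S)
     (\<lambda>e. snd (fst e) + transit I (base_arc e)) (cap_S S) (stor_S S) x' y' Tbar"
proof -
  have x: "x k e \<in> {0, 1}" if "k \<in> packets I" "e \<in> A_T I" for k e
    using feas that by (simp add: upr_feasible_def)
  have y: "y k e \<in> {0, 1}" if "k \<in> packets I" "e \<in> H_T I" for k e
    using feas that by (simp add: upr_feasible_def)
  have finK: "finite (packets I)" using routing by (simp add: routing_instance_def)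
  have "\<forall>k\<in>packets I. \<exists>P. P \<subseteq> moved (x k) \<union> held (x k) (y k) \<and>
      (\<forall>n. real (card {e \<in> P. fst e = n}) - real (card {e \<in> P. snd e = n})
         = of_bool (n = (origin I k, 0)) - of_bool (n = (destination I k, horizon I))) \<and>
      (origin I k, 0) \<noteq> (destination I k, horizon I)"
  proof
    fix k assume k: "k \<in> packets I"
    let ?s = "(origin I k, 0)" and ?d = "(destination I k, horizon I)"
    let ?E = "moved (x k) \<union> held (x k) (y k)"
    have N: "?s \<in> N_S S" "?d \<in> N_S S" using P1 k by (auto simp: P1_def)
    then have NT: "?s \<in> N_T I" "?d \<in> N_T I" using N_S_subset by auto
    have flow: "\<And>n. n \<in> N_T I \<Longrightarrow>
        (n = ?s \<longrightarrow> net_outflow (A_T I) (H_T I) (x k) (y k) n = 1) \<and>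
        (n = ?d \<longrightarrow> net_outflow (A_T I) (H_T I) (x k) (y k) n = -1) \<and>
        (n \<noteq> ?s \<and> n \<noteq> ?d \<longrightarrow> net_outflow (A_T I) (H_T I) (x k) (y k) n = 0)"
      using feas k unfolding upr_feasible_def flow_conservation_def by blast
    have "(?s, ?d) \<in> ({e \<in> A_T I. x k e \<noteq> 0} \<union> {e \<in> H_T I. y k e \<noteq> 0})\<^sup>*"
    proof (rule unit_outflow_imp_support_path[OF finite_N_T NT(1) A_T_subset H_T_subset])
      show "0 \<le> x k e" if "e \<in> A_T I" for e using x[OF k that] by auto
      show "0 \<le> y k e" if "e \<in> H_T I" for e using y[OF k that] by auto
    qed (use flow NT in auto)
    from path_rounding[OF this N(1)] obtain r where
      r: "covers (destination I k) r (horizon I)" "(?s, (destination I k, r)) \<in> ?E\<^sup>*" by blast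
    \<comment> \<open>By P1 the destination at the horizon is a copy, so it is its own rounding and
      the walk ends there.\<close>
    have "r = horizon I" using covers_unique r(1) covers_self[OF N(2)] by blast
    with r(2) have "(?s, ?d) \<in> ?E\<^sup>*" by simp
    \<comment> \<open>One node cannot have net outflow both 1 and -1. Without this, the path flow
      would have net outflow 0 there.\<close>
    moreover have "?s \<noteq> ?d" using flow[OF NT(1)] by auto
    ultimately show "\<exists>P. P \<subseteq> ?E \<and>
      (\<forall>n. real (card {e \<in> P. fst e = n}) - real (card {e \<in> P. snd e = n})
         = of_bool (n = ?s) - of_bool (n = ?d)) \<and> ?s \<noteq> ?d"
      by (elim rtrancl_imp_unit_flow) blast
  qed
  from bchoice[OF this] obtain P where P: "\<And>k. k \<in> packets I \<Longrightarrow> P k \<subseteq> moved (x k) \<union> held (x k) (y k)"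
    "\<And>k n. k \<in> packets I \<Longrightarrow> real (card {e \<in> P k. fst e = n}) - real (card {e \<in> P k. snd e = n})
         = of_bool (n = (origin I k, 0)) - of_bool (n = (destination I k, horizon I))"
    "\<And>k. k \<in> packets I \<Longrightarrow> (origin I k, 0) \<noteq> (destination I k, horizon I)"
    by blast
  \<comment> \<open>An arc lying in both \<open>moved\<close> and \<open>held\<close> is used as a
    movement arc, so no arc of the path is counted twice.\<close>
  define x' where "x' k e = (of_bool (e \<in> P k \<inter> moved (x k)) :: real)" for k e
  define y' where "y' k e = (of_bool (e \<in> P k - moved (x k)) :: real)" for k e
  have mov: "moved f \<subseteq> A_S S" for f by (auto simp: moved_def)
  have hel: "held f g \<subseteq> H_S I S" for f g by (auto simp: held_def)
  have cap: "(\<Sum>k\<in>packets I. restrict_A_T (x k) (move_arc v w a)) \<le> real (capacity I (v, w))" for v w a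
  proof (cases "move_arc v w a \<in> A_T I")
    case True
    then have "(\<Sum>k\<in>packets I. x k (move_arc v w a)) \<le> real (capacity I (base_arc (move_arc v w a)))"
      using feas unfolding upr_feasible_def by blast
    then show ?thesis using True by (simp add: restrict_A_T_def base_arc_def)
  qed (simp add: restrict_A_T_def)
  show ?thesis
  proof (rule exI[of _ x'], rule exI[of _ y'], unfold upr_feasible_def, intro conjI ballI)
    fix k e assume k: "k \<in> packets I" and e: "e \<in> A_S S"
    show "real (snd (fst e) + transit I (base_arc e)) * x' k e \<le> Tbar"
    proof (cases "e \<in> moved (x k)")
      case True
      then obtain v r w t a where a: "e = ((v, r), (w, t))" "covers v r a" "move_arc v w a \<in> A_T I"
        "x k (move_arc v w a) \<noteq> 0" by (auto simp: moved_def)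
      have "real (snd (snd (move_arc v w a))) * x k (move_arc v w a) \<le> Tbar"
        using feas k a(3) unfolding upr_feasible_def by blast
      moreover have "x k (move_arc v w a) = 1" using x[OF k a(3)] a(4) by simp
      ultimately have "real (r + transit I (v, w)) \<le> Tbar" using a(2) by (auto simp: covers_def)
      moreover have "real (r + transit I (v, w)) * x' k e \<le> real (r + transit I (v, w))"
        by (simp add: x'_def)
      ultimately show ?thesis using a(1) by (simp add: base_arc_def)
    next
      \<comment> \<open>Here \<open>x' k e\<close> is zero and \<open>0 \<le> Tbar\<close> remains,
        which follows from the nonnegative arrival sum.\<close>
      case False
      have "(\<Sum>e | e \<in> A_T I \<and> fst (snd e) = destination I k. real (snd (snd e)) * x k e) \<le> Tbar"
        using feas k unfolding upr_feasible_def by blast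
      moreover have "0 \<le> (\<Sum>e | e \<in> A_T I \<and> fst (snd e) = destination I k. real (snd (snd e)) * x k e)"
        by (rule sum_nonneg) (use x[OF k] in force)
      ultimately show ?thesis using False by (simp add: x'_def)
    qed
  next
    fix k assume k: "k \<in> packets I"
    have "(\<Sum>e | e \<in> A_S S \<and> fst (snd e) = destination I k.
        real (snd (fst e) + transit I (base_arc e)) * x' k e)
      \<le> (\<Sum>e | e \<in> A_T I \<and> fst (snd e) = destination I k. real (snd (snd e)) * x k e)"
      unfolding x'_def by (rule arrival_sum_le) (use x[OF k] in auto)
    also have "\<dots> \<le> Tbar" using feas k unfolding upr_feasible_def by blast
    finally show "(\<Sum>e | e \<in> A_S S \<and> fst (snd e) = destination I k.
        real (snd (fst e) + transit I (base_arc e)) * x' k e) \<le> Tbar" .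
  next
    have "net_outflow (A_S S) (H_S I S) (x' k) (y' k) n
        = of_bool (n = (origin I k, 0)) - of_bool (n = (destination I k, horizon I))"
      if k: "k \<in> packets I" for k n
      unfolding x'_def y'_def P(2)[OF k, symmetric]
      by (rule net_outflow_indicator[OF finite_A_S finite_H_S mov]) (use P(1)[OF k] hel in blast)
    then show "flow_conservation I (N_S S) (A_S S) (H_S I S) x' y'"
      using P(3) by (auto simp: flow_conservation_def)
  next
    fix e assume e: "e \<in> A_S S"
    obtain v r w t where eq: "e = ((v, r), (w, t))" by (metis prod.collapse)
    have "(\<Sum>k\<in>packets I. x' k e)
        \<le> (\<Sum>k\<in>packets I. \<Sum>a\<in>{r..<next_copy v r}. restrict_A_T (x k) (move_arc v w a))"
    proof (rule sum_mono)
      fix k assume "k \<in> packets I"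
      then show "x' k e \<le> (\<Sum>a\<in>{r..<next_copy v r}. restrict_A_T (x k) (move_arc v w a))"
        using moved_le[of "x k" v r w t] x unfolding x'_def eq by (force intro: order_trans[rotated])
    qed
    also have "\<dots> = (\<Sum>a\<in>{r..<next_copy v r}. \<Sum>k\<in>packets I. restrict_A_T (x k) (move_arc v w a))"
      by (rule sum.swap)
    also have "\<dots> \<le> (\<Sum>a\<in>{r..<next_copy v r}. real (capacity I (v, w)))"
      by (rule sum_mono) (rule cap)
    also have "\<dots> = cap_S S e"
      using P_arcs e by (simp add: P_arcs_def eq m_S_def)
    finally show "(\<Sum>k\<in>packets I. x' k e) \<le> cap_S S e" .
  next
    fix e assume e: "e \<in> H_S I S"
    then obtain v t n where eq: "e = ((v, t), (v, n))" by (auto simp: H_S_def)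
    have t: "(v, t) \<in> N_S S" "n = next_copy v t" "(v, n) \<in> N_S S"
      using e by (auto simp: H_S_def eq)
    have "t < n" using next_copy_gt N_S_le_horizon t by auto
    then have hT: "((v, n - 1), (v, n)) \<in> H_T I"
      using t(3) N_S_subset by (fastforce simp: H_T_def N_T_def)
    let ?K = "packets_through I v"
    let ?F = "\<lambda>k. \<Sum>(w, q)\<in>in_copies v t. \<Sum>a\<in>{q<..<next_copy w q}. restrict_A_T (x k) (move_arc w v a)"
    have K: "?K \<subseteq> packets I" by (auto simp: packets_through_def)
    have F0: "0 \<le> ?F k" if "k \<in> packets I" for k
    proof -
      have "0 \<le> restrict_A_T (x k) e" for e using x[OF that, of e] by (auto simp: restrict_A_T_def)
      then show ?thesis by (intro sum_nonneg) (auto intro: sum_nonneg)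
    qed
    have "(\<Sum>k\<in>?K. y' k e) \<le> (\<Sum>k\<in>?K. y k ((v, n - 1), (v, n)) + ?F k)"
    proof (rule sum_mono)
      fix k assume "k \<in> ?K"
      then have k: "k \<in> packets I" using K by auto
      have "y' k e \<le> of_bool (e \<in> held (x k) (y k))" using P(1)[OF k] by (auto simp: y'_def)
      also have "\<dots> \<le> y k ((v, n - 1), (v, n)) + ?F k"
        unfolding eq by (rule held_le) (use x[OF k] y[OF k] e eq in auto)
      finally show "y' k e \<le> y k ((v, n - 1), (v, n)) + ?F k" .
    qed
    also have "\<dots> = (\<Sum>k\<in>?K. y k ((v, n - 1), (v, n))) + (\<Sum>k\<in>?K. ?F k)"
      by (rule sum.distrib)
    also have "(\<Sum>k\<in>?K. y k ((v, n - 1), (v, n))) \<le> real (storage I v)"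
      using feas hT unfolding upr_feasible_def by fastforce
    \<comment> \<open>Early arrivals are bounded by movement capacities, which constrain the sum
      over all packets.\<close>
    also have "(\<Sum>k\<in>?K. ?F k) \<le> (\<Sum>k\<in>packets I. ?F k)"
      by (rule sum_mono2[OF finK K]) (use F0 in auto)
    also have "\<dots> = (\<Sum>(w, q)\<in>in_copies v t. \<Sum>a\<in>{q<..<next_copy w q}.
        \<Sum>k\<in>packets I. restrict_A_T (x k) (move_arc w v a))"
      by (subst sum.swap, intro sum.cong refl, clarsimp) (rule sum.swap)
    also have "\<dots> \<le> (\<Sum>(w, q)\<in>in_copies v t. \<Sum>a\<in>{q<..<next_copy w q}. real (capacity I (w, v)))"
      unfolding case_prod_unfold by (intro sum_mono cap)
    also have "\<dots> = real (U_S I S v t)"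
      by (simp add: U_S_def in_copies_def m_S_def case_prod_unfold mult.commute)
    \<comment> \<open>Both cases of \<open>P_storage\<close> provide at least this much.\<close>
    also have "real (storage I v) + real (U_S I S v t) \<le> stor_S S e"
      using P_storage e unfolding P_storage_def eq
      by (cases "(v, t + 1) \<in> N_S S") (fastforce simp: eq)+
    finally show "(\<Sum>k\<in>packets_through I (fst (fst e)). y' k e) \<le> stor_S S e"
      by (simp add: eq)
  qed (auto simp: x'_def y'_def)
qed

end

theorem theorem1:
  fixes I :: "('v, 'k) routing"
    and S :: "'v partial_network"
  assumes "routing_instance I"
    and "partial_network I S"
    and "P1 I S" and "P2 I S" and "P3 I S" and "P4 I S"
    and "P_arcs I S" and "P_storage I S"
  shows "opt_UPR_S I S \<le> opt_UPR_T I"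
proof -
  interpret partial_expansion I S using assms by unfold_locales
  show ?thesis
    unfolding opt_UPR_S_def opt_UPR_T_def upr_value_def
    \<comment> \<open>Every \<open>Tbar\<close> feasible in the full network is feasible in the
      partial one. Comparing infima also covers an infeasible full program, whose value is
      infinite.\<close>
    by (rule Inf_superset_mono) (use feasible_rounding in blast)
qed

end
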